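(* Let $I_G$ be the modified edge ideal of a graph $G$. The general algorithm (described in the context) for computing the Hilbert series of $\mathbb{C}[x_1,\dots,x_n]/I_G$ has the specialized version $\mathtt{S}$ presented in the context. The algorithm $\mathtt{S}$ has an obvious graphical interpretation. The choice of a variable $x_i$ in step 2 of $\mathtt{S}$ corresponds to choosing a node $v$ of the graph. The recursive calls of step 5 of $\mathtt{S}$ correspond to counting the independent sets of $G$ that contain $v$ ($HS_{\mathrm{Colon}}$) and those that do not contain $v$ ($HS_{\mathrm{Plus}}$).
   Context: Let $G=(V,E)$ be a graph with $V=\{v_1,\dots,v_n\}$. The modified edge ideal of $G$ is $I_G=\langle x_ix_j : (v_i,v_j)\in E\rangle+\langle x_i^2 : 1\le i\le n\rangle\subseteq\mathbb{C}[x_1,\dots,x_n]$; the listed monomials are its minimal monomial generators. An independent set of $G$ is a set of pairwise non-adjacent nodes. For a positively graded finitely generated $\mathbb{C}[x_1,\dots,x_n]$-module $M=\bigoplus_{i\ge 0}M_i$, the Hilbert series is $HS_M(z)=\sum_{i\ge 0}\dim_{\mathbb{C}}(M_i)\,z^i$. For $M=\mathbb{C}[x_1,\dots,x_n]/I$ with $I$ a monomial ideal, $HS_M(z)=HN_M(z)/(1-z)^n$, where $HN_M(z)$ is called the Hilbert numerator. General algorithm: compute the Hilbert numerator by the recursive algorithm $\mathtt{HN}$ below; the Hilbert series is then obtained by dividing by $(1-z)^n$. Algorithm $\mathtt{HN}$ (input: a set of minimal monomial generators of a monomial ideal $I$; output: the Hilbert numerator of $\mathbb{C}[x_1,\dots,x_n]/I$):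 if the minimal generators of $I$ are pairwise coprime, return $\prod_i(1-z^{d_i})$, where $d_i$ is the degree of the $i$-th generator of $I$. Otherwise choose a monomial $p$ as pivot, set $f_1=\mathtt{HN}(I:p)$ and $f_2=\mathtt{HN}(I+\langle p\rangle)$, and return $z^{\deg p}f_1(z)+f_2(z)$. The choice of pivot must satisfy $\sum\deg(I:p)<\sum\deg(I)$ and $\sum\deg(I+\langle p\rangle)<\sum\deg(I)$, where $\sum\deg(I)$ denotes the sum of the degrees of all the minimal monomial generators of $I$. Specialized algorithm $\mathtt{S}$ (input: the list $L$ of minimal monomial generators of $I_G$ given above; output: the Hilbert series of $\mathbb{C}[x_1,\dots,x_n]/I_G$). Step 1: if $L$ consists only of variables and squares of variables, return $(1+z)^k$, where $k$ is the number of variables which appear squared in $L$. Step 2: otherwise choose a variable $x_i$ that appears squared in $L$. Step 3: let Colon be a minimal set of monomial generators of $(\langle L\rangle : x_i)$. Step 4: let Plus be a minimal set of monomial generators of $\langle L,x_i\rangle$. Step 5: return $z\,HS_{\mathrm{Colon}}(z)+HS_{\mathrm{Plus}}(z)$, where $HS_{\mathrm{Colon}}$ and $HS_{\mathrm{Plus}}$ are the results of the recursive calls of the algorithm on the lists Colon and Plus. *)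

theory Defs
  imports
    "HOL-Algebra.Embedded_Algebras"
    "HOL-Algebra.QuotRing"
    "HOL-Library.Poly_Mapping"
    "HOL-Computational_Algebra.Formal_Power_Series"
begin

section \<open>Polynomial rings and monomial ideals\<close>

text \<open>Monomials are finitely supported exponent vectors, so the product of monomials is the sum
  of exponent vectors.\<close>

type_synonym 'v monomial = "'v \<Rightarrow>\<^sub>0 nat"
type_synonym 'v cpoly = "'v monomial \<Rightarrow>\<^sub>0 complex"

definition var :: "'v \<Rightarrow> 'v monomial" where
  "var v = Poly_Mapping.single v 1"

definition monomials :: "'v set \<Rightarrow> 'v monomial set" where
  "monomials V = {m. Poly_Mapping.keys m \<subseteq> V}"

definition mdeg :: "'v monomial \<Rightarrow> nat" where
  "mdeg m = (\<Sum>v\<in>Poly_Mapping.keys m. Poly_Mapping.lookup m v)"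

definition coprime_monomials :: "'v monomial \<Rightarrow> 'v monomial \<Rightarrow> bool" where
  "coprime_monomials m m' \<longleftrightarrow> Poly_Mapping.keys m \<inter> Poly_Mapping.keys m' = {}"

definition monom_poly :: "'v monomial \<Rightarrow> 'v cpoly" where
  "monom_poly m = Poly_Mapping.single m 1"

text \<open>The ring of complex polynomials in the variables indexed by \<^term>\<open>V\<close>.\<close>

definition poly_ring :: "'v set \<Rightarrow> 'v cpoly ring" where
  "poly_ring V =
     \<lparr>carrier = {f. Poly_Mapping.keys f \<subseteq> monomials V}, monoid.mult = (*), one = 1, zero = 0, add = (+)\<rparr>"

definition mono_ideal :: "'v set \<Rightarrow> 'v monomial set \<Rightarrow> 'v cpoly set" where
  "mono_ideal V L = Idl\<^bsub>poly_ring V\<^esub> (monom_poly ` L)"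

definition colon_ideal :: "'v set \<Rightarrow> 'v cpoly set \<Rightarrow> 'v cpoly \<Rightarrow> 'v cpoly set" where
  "colon_ideal V I p = {f \<in> carrier (poly_ring V). f \<otimes>\<^bsub>poly_ring V\<^esub> p \<in> I}"

definition is_min_gens :: "'v set \<Rightarrow> 'v cpoly set \<Rightarrow> 'v monomial set \<Rightarrow> bool" where
  "is_min_gens V I L \<longleftrightarrow> finite L \<and> L \<subseteq> monomials V \<and> mono_ideal V L = I \<and>
     (\<forall>L'. L' \<subset> L \<longrightarrow> mono_ideal V L' \<noteq> I)"

section \<open>Hilbert series\<close>

text \<open>The quotient of the polynomial ring by an ideal \<^term>\<open>I\<close> is a complex vector space through the
  image of the constants; its component of degree \<^term>\<open>d\<close> is the image of the forms of
  degree \<^term>\<open>d\<close>. This is meant for homogeneous \<^term>\<open>I\<close>.\<close>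

definition quot_scalars :: "'v set \<Rightarrow> 'v cpoly set \<Rightarrow> 'v cpoly set set" where
  "quot_scalars V I = (\<lambda>c. I +>\<^bsub>poly_ring V\<^esub> Poly_Mapping.single 0 c) ` UNIV"

definition quot_component :: "'v set \<Rightarrow> 'v cpoly set \<Rightarrow> nat \<Rightarrow> 'v cpoly set set" where
  "quot_component V I d =
     (\<lambda>f. I +>\<^bsub>poly_ring V\<^esub> f) `
       {f \<in> carrier (poly_ring V). \<forall>m\<in>Poly_Mapping.keys f. mdeg m = d}"

definition hilbert_series :: "'v set \<Rightarrow> 'v cpoly set \<Rightarrow> rat fps" where
  "hilbert_series V I = Abs_fps (\<lambda>d. of_nat
     (ring.dim (poly_ring V Quot I) (quot_scalars V I) (quot_component V I d)))"

section \<open>Modified edge ideals and independent sets\<close>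

definition modified_edge_ideal :: "'v set \<Rightarrow> ('v \<times> 'v) set \<Rightarrow> 'v cpoly set" where
  "modified_edge_ideal V E =
     mono_ideal V {var u + var v | u v. (u, v) \<in> E} <+>\<^bsub>poly_ring V\<^esub>
     mono_ideal V {var v + var v | v. v \<in> V}"

definition edge_gens :: "'v set \<Rightarrow> ('v \<times> 'v) set \<Rightarrow> 'v monomial set" where
  "edge_gens V E = {var u + var v | u v. (u, v) \<in> E} \<union> {var v + var v | v. v \<in> V}"

definition independent_set :: "'v set \<Rightarrow> ('v \<times> 'v) set \<Rightarrow> 'v set \<Rightarrow> bool" where
  "independent_set V E S \<longleftrightarrow> S \<subseteq> V \<and> pairwise (\<lambda>u v. (u, v) \<notin> E) S"

text \<open>The graph read off from a list of generators: its nodes are the variables that appear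
  squared, and its edges are the products of two distinct variables.\<close>

definition nodes_of :: "'v set \<Rightarrow> 'v monomial set \<Rightarrow> 'v set" where
  "nodes_of V L = {v \<in> V. var v + var v \<in> L}"

definition edges_of :: "'v set \<Rightarrow> 'v monomial set \<Rightarrow> ('v \<times> 'v) set" where
  "edges_of V L = {(u, v). u \<in> V \<and> v \<in> V \<and> u \<noteq> v \<and> var u + var v \<in> L}"

section \<open>The general algorithm\<close>

text \<open>Both algorithms leave choices open, so they are given as big-step relations between an input,
  the tree of choices made during a run, and the result. Lists of generators are represented by
  sets of monomials.\<close>

datatype 'p run = Done | Split 'p "'p run" "'p run"

definition sum_deg :: "'v monomial set \<Rightarrow> nat" where
  "sum_deg L = (\<Sum>m\<in>L. mdeg m)"

inductive HN_run :: "'v set \<Rightarrow> 'v monomial set \<Rightarrow> 'v monomial run \<Rightarrow> rat fps \<Rightarrow> bool"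
  for V :: "'v set" where
  coprime: "pairwise coprime_monomials L \<Longrightarrow>
    HN_run V L Done (\<Prod>m\<in>L. 1 - fps_X ^ mdeg m)"
| pivot: "\<lbrakk> \<not> pairwise coprime_monomials L;
      p \<in> monomials V;
      is_min_gens V (colon_ideal V (mono_ideal V L) (monom_poly p)) C;
      is_min_gens V (mono_ideal V L <+>\<^bsub>poly_ring V\<^esub> mono_ideal V {p}) P;
      sum_deg C < sum_deg L;
      sum_deg P < sum_deg L;
      HN_run V C t1 f1;
      HN_run V P t2 f2 \<rbrakk> \<Longrightarrow>
    HN_run V L (Split p t1 t2) (fps_X ^ mdeg p * f1 + f2)"

section \<open>The specialized algorithm\<close>

definition only_vars_and_squares :: "'v set \<Rightarrow> 'v monomial set \<Rightarrow> bool" where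
  "only_vars_and_squares V L \<longleftrightarrow> (\<forall>m\<in>L. \<exists>v\<in>V. m = var v \<or> m = var v + var v)"

text \<open>Steps 2 to 4: \<^term>\<open>v\<close> is the chosen variable, \<^term>\<open>C\<close> and \<^term>\<open>P\<close> are the sets Colon and
  Plus.\<close>

definition S_split ::
  "'v set \<Rightarrow> 'v monomial set \<Rightarrow> 'v \<Rightarrow> 'v monomial set \<Rightarrow> 'v monomial set \<Rightarrow> bool" where
  "S_split V L v C P \<longleftrightarrow>
     \<not> only_vars_and_squares V L \<and> v \<in> V \<and> var v + var v \<in> L \<and>
     is_min_gens V (colon_ideal V (mono_ideal V L) (monom_poly (var v))) C \<and>
     is_min_gens V (mono_ideal V (insert (var v) L)) P"

inductive S_run :: "'v set \<Rightarrow> 'v monomial set \<Rightarrow> 'v run \<Rightarrow> rat fps \<Rightarrow> bool"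
  for V :: "'v set" where
  base: "only_vars_and_squares V L \<Longrightarrow>
    S_run V L Done ((1 + fps_X) ^ card {v \<in> V. var v + var v \<in> L})"
| split: "\<lbrakk> S_split V L v C P; S_run V C t1 f1; S_run V P t2 f2 \<rbrakk> \<Longrightarrow>
    S_run V L (Split v t1 t2) (fps_X * f1 + f2)"

definition S_call :: "'v set \<Rightarrow> 'v monomial set \<Rightarrow> 'v monomial set \<Rightarrow> bool" where
  "S_call V L L' \<longleftrightarrow> (\<exists>v C P. S_split V L v C P \<and> (L' = C \<or> L' = P))"

definition S_reachable :: "'v set \<Rightarrow> 'v monomial set \<Rightarrow> 'v monomial set \<Rightarrow> bool" where
  "S_reachable V = (S_call V)\<^sup>*\<^sup>*"

end

theory Submission
  imports Defs
begin

text \<open>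
  The specialized algorithm deletes nodes from the graph. Its state at any time is described by the set
  \<open>A\<close> of nodes that are still present, and the list of generators is then \<open>live_gens A\<close>: the variables of
  the deleted nodes, the squares of the variables of the nodes in \<open>A\<close>, and the products belonging
  to the edges inside \<open>A\<close>. The input is \<open>live_gens V\<close>. A monomial outside the ideal generated
  by \<open>live_gens A\<close> is exactly the product of the variables of an independent set contained
  in \<open>A\<close> (\<open>not_multiple_live_gens_iff\<close>).

  From this description follow the two identities that carry the theorem: the colon ideal by the variable of
  \<open>v\<close> is generated by \<open>live_gens\<close> of \<open>A\<close> without \<open>v\<close> and its neighbours (\<open>colon_live_gens\<close>), and adding the
  variable of \<open>v\<close> yields the ideal generated by \<open>live_gens\<close> of \<open>A\<close> without \<open>v\<close> (\<open>plus_live_gens\<close>). Both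
  follow by comparing standard monomials, because a monomial ideal is the linear span of
  its monomials (\<open>mono_ideal_eq_span\<close>). Since minimal monomial generators are unique (\<open>min_gens_unique\<close>)
  and \<open>live_gens A\<close> is an antichain for divisibility, the algorithm has no choice besides
  that of \<open>v\<close>. It can always be continued while \<open>A\<close> contains an edge, and \<open>A\<close> strictly shrinks.

  The standard monomials of degree \<open>d\<close> form a basis of the degree \<open>d\<close> component of the quotient
  (\<open>hilbert_series_mono_ideal\<close>), so its Hilbert series is the independence polynomial of the subgraph induced
  on \<open>A\<close> (\<open>hilbert_series_live_gens\<close>). Splitting the independent sets into those with and those without \<open>v\<close>
  gives the recursion of the algorithm (\<open>indep_poly_rec\<close>), whence the result and the graphical
  interpretation. Multiplying all results of a run by \<open>(1 - z)^n\<close>, where \<open>n\<close> is the number of nodes of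
  the original graph, turns the run into one of the general algorithm with the chosen
  variables as pivots (\<open>S_run_live_gens\<close>). At the leaves this is the identity
  \<open>(1 - z)^(n - a) (1 - z^2)^a = (1 + z)^a (1 - z)^n\<close>, where \<open>a\<close> is the size of \<open>A\<close>.
\<close>

section \<open>Divisibility of monomials\<close>

text \<open>Divisibility of monomials is stated through exponents rather than through \<^term>\<open>\<exists>k. m = l + k\<close>:
  for the generators that occur here it then unfolds to a condition on at most two exponents.\<close>

definition mono_dvd :: "'v monomial \<Rightarrow> 'v monomial \<Rightarrow> bool" where
  "mono_dvd l m \<longleftrightarrow> (\<forall>v. Poly_Mapping.lookup l v \<le> Poly_Mapping.lookup m v)"

text \<open>The monomials of the monomial ideal generated by \<^term>\<open>L\<close>.\<close>

definition multiples :: "'v set \<Rightarrow> 'v monomial set \<Rightarrow> 'v monomial set" where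
  "multiples V L = {m \<in> monomials V. \<exists>l\<in>L. mono_dvd l m}"

definition mono_span :: "'v monomial set \<Rightarrow> 'v cpoly set" where
  "mono_span M = {f. Poly_Mapping.keys f \<subseteq> M}"

lemma mono_dvd_refl [simp]: "mono_dvd m m"
  by (simp add: mono_dvd_def)

lemma mono_dvd_trans: "mono_dvd l m \<Longrightarrow> mono_dvd m k \<Longrightarrow> mono_dvd l k"
  unfolding mono_dvd_def by (meson order_trans)

lemma mono_dvd_antisym: "mono_dvd l m \<Longrightarrow> mono_dvd m l \<Longrightarrow> l = m"
  by (rule poly_mapping_eqI) (auto simp: mono_dvd_def intro: antisym)

lemma mono_dvd_add: "mono_dvd l (l + k)"
  by (simp add: mono_dvd_def lookup_add)

lemma mono_dvdE:
  assumes "mono_dvd l m"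
  obtains k where "m = l + k"
proof
  show "m = l + (m - l)"
    using assms by (intro poly_mapping_eqI) (simp add: mono_dvd_def lookup_add lookup_minus)
qed

lemma keys_add_monomial:
  "Poly_Mapping.keys (m + k :: 'v monomial) = Poly_Mapping.keys m \<union> Poly_Mapping.keys k"
  by (auto simp: in_keys_iff lookup_add)

lemma monomials_add_iff [simp]:
  "m + k \<in> monomials V \<longleftrightarrow> m \<in> monomials V \<and> k \<in> monomials V"
  by (auto simp: monomials_def keys_add_monomial)

lemma zero_in_monomials [simp]: "0 \<in> monomials V"
  by (simp add: monomials_def)

lemma multiples_add: "m \<in> multiples V L \<Longrightarrow> k \<in> monomials V \<Longrightarrow> k + m \<in> multiples V L"
  unfolding multiples_def using mono_dvd_trans mono_dvd_add[of m k] by (auto simp: add.commute[of k])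

lemma gens_subset_multiples: "L \<subseteq> monomials V \<Longrightarrow> L \<subseteq> multiples V L"
  unfolding multiples_def using mono_dvd_refl by blast

lemma multiples_subset: "multiples V L \<subseteq> monomials V"
  by (auto simp: multiples_def)

section \<open>Spans of monomials and the polynomial ring\<close>

lemma mono_span_zero [simp]: "0 \<in> mono_span M"
  by (simp add: mono_span_def)

lemma mono_span_single_iff [simp]: "Poly_Mapping.single m c \<in> mono_span M \<longleftrightarrow> c = 0 \<or> m \<in> M"
  by (simp add: mono_span_def)

lemma one_in_mono_span_iff [simp]: "1 \<in> mono_span M \<longleftrightarrow> 0 \<in> M"
  by (simp add: mono_span_def)

lemma mono_span_add: "f \<in> mono_span M \<Longrightarrow> g \<in> mono_span M \<Longrightarrow> f + g \<in> mono_span M"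
  unfolding mono_span_def using keys_add[of f g] by auto

lemma mono_span_uminus [simp]: "- f \<in> mono_span M \<longleftrightarrow> f \<in> mono_span M"
  by (auto simp: mono_span_def in_keys_iff)

lemma mono_span_mult:
  "\<lbrakk>f \<in> mono_span M; g \<in> mono_span N; \<And>m n. m \<in> M \<Longrightarrow> n \<in> N \<Longrightarrow> m + n \<in> K\<rbrakk>
    \<Longrightarrow> f * g \<in> mono_span K"
  unfolding mono_span_def using keys_mult[of f g] by blast

lemma mono_span_mono: "M \<subseteq> N \<Longrightarrow> mono_span M \<subseteq> mono_span N"
  by (auto simp: mono_span_def)

lemma sum_of_terms:
  fixes f :: "'v cpoly"
  shows "f = (\<Sum>m\<in>Poly_Mapping.keys f. Poly_Mapping.single m (Poly_Mapping.lookup f m))"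
  by (rule poly_mapping_eqI) (simp add: lookup_sum lookup_single when_def in_keys_iff)

text \<open>Multiplication by a monomial shifts exponents and cannot cancel terms. This is what keeps the colon
  of a monomial ideal by a monomial a monomial ideal.\<close>

lemma lookup_mult_monom:
  fixes f :: "'v cpoly"
  shows "Poly_Mapping.lookup (f * Poly_Mapping.single p 1) (m + p) = Poly_Mapping.lookup f m"
proof -
  have "f * Poly_Mapping.single p 1 =
      (\<Sum>m\<in>Poly_Mapping.keys f. Poly_Mapping.single (m + p) (Poly_Mapping.lookup f m))"
    by (subst sum_of_terms[of f]) (simp add: sum_distrib_right mult_single)
  then show ?thesis
    by (simp add: lookup_sum lookup_single when_def in_keys_iff)
qed

lemma poly_ring_simps [simp]:
  "carrier (poly_ring V) = mono_span (monomials V)"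
  "\<zero>\<^bsub>poly_ring V\<^esub> = 0" "\<one>\<^bsub>poly_ring V\<^esub> = 1"
  "f \<oplus>\<^bsub>poly_ring V\<^esub> g = f + g" "f \<otimes>\<^bsub>poly_ring V\<^esub> g = f * g"
  by (simp_all add: poly_ring_def mono_span_def)

lemma poly_ring_cring: "cring (poly_ring V)"
proof (rule cringI)
  show "abelian_group (poly_ring V)"
  proof (rule abelian_groupI)
    fix f assume "f \<in> carrier (poly_ring V)"
    then show "\<exists>g\<in>carrier (poly_ring V). g \<oplus>\<^bsub>poly_ring V\<^esub> f = \<zero>\<^bsub>poly_ring V\<^esub>"
      by (intro bexI[of _ "- f"]) auto
  qed (auto simp: algebra_simps intro: mono_span_add)
  show "comm_monoid (poly_ring V)"
    by (rule comm_monoidI)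
      (auto simp: algebra_simps intro: mono_span_mult)
qed (auto simp: algebra_simps)

lemma poly_ring_ring: "ring (poly_ring V)"
  using poly_ring_cring by (rule cring.axioms)

lemma poly_ring_a_inv [simp]:
  assumes "f \<in> mono_span (monomials V)"
  shows "\<ominus>\<^bsub>poly_ring V\<^esub> f = - f"
proof -
  interpret cring "poly_ring V" by (rule poly_ring_cring)
  show ?thesis by (rule minus_equality) (use assms in auto)
qed

lemma poly_ring_a_minus [simp]:
  "\<lbrakk>f \<in> mono_span (monomials V); g \<in> mono_span (monomials V)\<rbrakk> \<Longrightarrow> f \<ominus>\<^bsub>poly_ring V\<^esub> g = f - g"
  by (simp add: a_minus_def)

section \<open>Monomial ideals and their minimal generators\<close>

lemma mono_span_multiples_ideal: "ideal (mono_span (multiples V L)) (poly_ring V)"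
proof -
  interpret cring "poly_ring V" by (rule poly_ring_cring)
  have mult: "g * f \<in> mono_span (multiples V L)"
    if "f \<in> mono_span (multiples V L)" "g \<in> mono_span (monomials V)" for f g
    using that(2,1) by (rule mono_span_mult) (rule multiples_add)
  show ?thesis
  proof (rule idealI)
    show "subgroup (mono_span (multiples V L)) (add_monoid (poly_ring V))"
    proof (rule add.subgroupI)
      show "mono_span (multiples V L) \<subseteq> carrier (poly_ring V)"
        using mono_span_mono[OF multiples_subset] by simp
      show "mono_span (multiples V L) \<noteq> {}" using mono_span_zero by blast
    next
      fix f assume f: "f \<in> mono_span (multiples V L)"
      with mono_span_mono[OF multiples_subset, of V L]
      show "\<ominus>\<^bsub>poly_ring V\<^esub> f \<in> mono_span (multiples V L)"
        by (subst poly_ring_a_inv) auto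
    qed (auto intro: mono_span_add)
  next
    fix f g assume "f \<in> mono_span (multiples V L)" "g \<in> carrier (poly_ring V)"
    then have "g * f \<in> mono_span (multiples V L)" using mult by simp
    then show "g \<otimes>\<^bsub>poly_ring V\<^esub> f \<in> mono_span (multiples V L)"
      "f \<otimes>\<^bsub>poly_ring V\<^esub> g \<in> mono_span (multiples V L)" by (simp_all add: mult.commute)
  qed (rule poly_ring_ring)
qed

text \<open>The multiples of the generators span an ideal, because multiplying a term of a polynomial by
  a term yields a multiple of the former; and every ideal containing the generators contains each
  single multiple, hence their span. All statements about ideals are reduced to
  statements about sets of monomials through this lemma.\<close>

lemma mono_ideal_eq_span:
  assumes "L \<subseteq> monomials V"
  shows "mono_ideal V L = mono_span (multiples V L)"
proof
  interpret cring "poly_ring V" by (rule poly_ring_cring)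
  have sub: "monom_poly ` L \<subseteq> carrier (poly_ring V)"
    using assms by (auto simp: monom_poly_def)
  show "mono_ideal V L \<subseteq> mono_span (multiples V L)"
    unfolding mono_ideal_def
    using gens_subset_multiples[OF assms]
    by (intro genideal_minimal mono_span_multiples_ideal) (auto simp: monom_poly_def)
  interpret I: ideal "mono_ideal V L" "poly_ring V"
    unfolding mono_ideal_def by (rule genideal_ideal[OF sub])
  show "mono_span (multiples V L) \<subseteq> mono_ideal V L"
  proof
    fix f assume f: "f \<in> mono_span (multiples V L)"
    have monom: "Poly_Mapping.single m c \<in> mono_ideal V L" if mult: "m \<in> multiples V L" for m c
    proof -
      from mult obtain l where l: "l \<in> L" "mono_dvd l m" and m: "m \<in> monomials V"
        unfolding multiples_def by blast
      obtain k where k: "m = l + k" using l(2) by (rule mono_dvdE)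
      have "monom_poly l \<in> mono_ideal V L"
        unfolding mono_ideal_def using genideal_self[OF sub] l(1) by blast
      then have "monom_poly l * Poly_Mapping.single k c \<in> mono_ideal V L"
        using I.I_r_closed[of "monom_poly l" "Poly_Mapping.single k c"] m by (simp add: k)
      then show ?thesis by (simp add: monom_poly_def mult_single k)
    qed
    have sum: "sum g A \<in> mono_ideal V L" if "\<And>x. x \<in> A \<Longrightarrow> g x \<in> mono_ideal V L" for g A
      using that I.zero_closed I.a_closed by (induction A rule: infinite_finite_induct) auto
    show "f \<in> mono_ideal V L"
      by (subst sum_of_terms, rule sum, rule monom) (use f in \<open>auto simp: mono_span_def\<close>)
  qed
qed

lemma mono_span_inject: "mono_span M = mono_span N \<longleftrightarrow> M = N"
proof
  assume eq: "mono_span M = mono_span N"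
  have "m \<in> M \<longleftrightarrow> Poly_Mapping.single m 1 \<in> mono_span M"
    "m \<in> N \<longleftrightarrow> Poly_Mapping.single m 1 \<in> mono_span N" for m by simp_all
  with eq show "M = N" by blast
qed simp

lemma mono_ideal_eq_iff:
  assumes "L \<subseteq> monomials V" "L' \<subseteq> monomials V"
  shows "mono_ideal V L = mono_ideal V L' \<longleftrightarrow> multiples V L = multiples V L'"
  using assms by (simp add: mono_ideal_eq_span mono_span_inject)

lemma is_min_gens_antichain:
  assumes "finite L" "L \<subseteq> monomials V"
    and anti: "\<And>l m. l \<in> L \<Longrightarrow> m \<in> L \<Longrightarrow> mono_dvd l m \<Longrightarrow> l = m"
  shows "is_min_gens V (mono_ideal V L) L"
  unfolding is_min_gens_def
proof (intro conjI allI impI notI)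
  fix L' assume L': "L' \<subset> L" and eq: "mono_ideal V L' = mono_ideal V L"
  then have "multiples V L' = multiples V L"
    using assms(2) by (subst (asm) mono_ideal_eq_iff) auto
  moreover obtain m where m: "m \<in> L" "m \<notin> L'" using L' by auto
  moreover have "m \<in> multiples V L"
    using m(1) gens_subset_multiples[OF assms(2)] by auto
  ultimately obtain l where "l \<in> L'" "mono_dvd l m" by (auto simp: multiples_def)
  with anti[of l m] m L' show False by auto
qed (use assms in auto)

text \<open>A generator divisible by another one could be dropped.\<close>

lemma min_gens_antichain:
  assumes "is_min_gens V I L" "l \<in> L" "m \<in> L" "mono_dvd l m"
  shows "l = m"
proof (rule ccontr)
  assume "l \<noteq> m"
  with assms(2,4) have "multiples V (L - {m}) = multiples V L"
    unfolding multiples_def by (auto intro: mono_dvd_trans)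
  then have "mono_ideal V (L - {m}) = I"
    using assms(1) mono_ideal_eq_iff[of "L - {m}" V L] by (auto simp: is_min_gens_def)
  with assms(1,3) show False by (auto simp: is_min_gens_def)
qed

text \<open>If \<^term>\<open>l\<close> is in one generating set, it is a multiple of some \<^term>\<open>l'\<close> in the other one, which is
  in turn a multiple of some \<^term>\<open>l''\<close> in the first one. Minimality forces \<^term>\<open>l'' = l\<close>, so all
  three agree. Hence the sets Colon and Plus of a step of the algorithm are determined
  by the chosen variable.\<close>

lemma min_gens_unique:
  assumes "is_min_gens V I L" "is_min_gens V I L'"
  shows "L = L'"
proof -
  have "L \<subseteq> L'" if L: "is_min_gens V I L" and L': "is_min_gens V I L'" for L L'
  proof
    fix l assume l: "l \<in> L"
    have sub: "L \<subseteq> monomials V" "L' \<subseteq> monomials V"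
      and eq: "multiples V L = multiples V L'"
      using L L' mono_ideal_eq_iff[of L V L'] by (auto simp: is_min_gens_def)
    have "l \<in> multiples V L'"
      unfolding eq[symmetric] using l gens_subset_multiples[OF sub(1)] by auto
    then obtain l' where l': "l' \<in> L'" "mono_dvd l' l" by (auto simp: multiples_def)
    then have "l' \<in> multiples V L"
      unfolding eq using gens_subset_multiples[OF sub(2)] by auto
    then obtain l'' where l'': "l'' \<in> L" "mono_dvd l'' l'" by (auto simp: multiples_def)
    then have "l'' = l"
      using min_gens_antichain[OF L] l l' mono_dvd_trans by blast
    with l' l'' show "l \<in> L'" using mono_dvd_antisym by blast
  qed
  with assms show ?thesis by blast
qed

lemma colon_ideal_span:
  assumes "L \<subseteq> monomials V" "p \<in> monomials V"
  shows "colon_ideal V (mono_ideal V L) (monom_poly p) =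
    mono_span {m \<in> monomials V. m + p \<in> multiples V L}"
proof -
  have "Poly_Mapping.keys (f * Poly_Mapping.single p 1) = (\<lambda>m. m + p) ` Poly_Mapping.keys f"
    for f :: "'a cpoly"
    using keys_mult[of f "Poly_Mapping.single p 1"]
    by (auto simp: in_keys_iff lookup_mult_monom)
  then show ?thesis
    using assms by (auto simp: colon_ideal_def mono_ideal_eq_span monom_poly_def mono_span_def)
qed

lemma mono_ideal_sum:
  assumes "L \<subseteq> monomials V" "L' \<subseteq> monomials V"
  shows "mono_ideal V L <+>\<^bsub>poly_ring V\<^esub> mono_ideal V L' = mono_ideal V (L \<union> L')"
proof -
  interpret cring "poly_ring V" by (rule poly_ring_cring)
  have sub: "monom_poly ` L \<subseteq> carrier (poly_ring V)" "monom_poly ` L' \<subseteq> carrier (poly_ring V)"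
    using assms by (auto simp: monom_poly_def)
  have I: "ideal (mono_ideal V L) (poly_ring V)" "ideal (mono_ideal V L') (poly_ring V)"
    "ideal (mono_ideal V (L \<union> L')) (poly_ring V)"
    unfolding mono_ideal_def using sub by (auto intro!: genideal_ideal simp: image_Un)
  have "Idl\<^bsub>poly_ring V\<^esub> (mono_ideal V L \<union> mono_ideal V L') = mono_ideal V (L \<union> L')"
  proof
    show "Idl\<^bsub>poly_ring V\<^esub> (mono_ideal V L \<union> mono_ideal V L') \<subseteq> mono_ideal V (L \<union> L')"
      using assms by (intro genideal_minimal I) (auto simp: mono_ideal_eq_span mono_span_def multiples_def)
    have "mono_ideal V L \<union> mono_ideal V L' \<subseteq> carrier (poly_ring V)"
      using assms by (auto simp: mono_ideal_eq_span mono_span_def multiples_def)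
    note genideal_ideal[OF this] genideal_self[OF this]
    moreover have "monom_poly ` L \<subseteq> mono_ideal V L" "monom_poly ` L' \<subseteq> mono_ideal V L'"
      unfolding mono_ideal_def using genideal_self sub by blast+
    ultimately show "mono_ideal V (L \<union> L') \<subseteq> Idl\<^bsub>poly_ring V\<^esub> (mono_ideal V L \<union> mono_ideal V L')"
      unfolding mono_ideal_def[of V "L \<union> L'"] by (intro genideal_minimal) auto
  qed
  with union_genideal[OF I(1,2)] show ?thesis by simp
qed

section \<open>Standard monomials and the Hilbert series\<close>

lemma constants_subfield: "subfield (range (Poly_Mapping.single 0)) (poly_ring V)"
proof -
  interpret cring "poly_ring V" by (rule poly_ring_cring)
  let ?K = "range (Poly_Mapping.single 0) :: 'a cpoly set"
  have ring: "subring ?K (poly_ring V)"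
  proof (rule subringI)
    show "\<one>\<^bsub>poly_ring V\<^esub> \<in> ?K" by (simp add: image_iff) (metis single_one)
  qed (auto simp: mult_single single_add[symmetric] single_uminus[symmetric])
  show ?thesis
  proof (rule subfieldI)
    show "subcring ?K (poly_ring V)"
      using ring by (rule subcringI) (auto simp: mult_single mult.commute)
    show "Units (poly_ring V\<lparr>carrier := ?K\<rparr>) = ?K - {\<zero>\<^bsub>poly_ring V\<^esub>}"
    proof (intro equalityI subsetI)
      fix x assume "x \<in> Units (poly_ring V\<lparr>carrier := ?K\<rparr>)"
      then show "x \<in> ?K - {\<zero>\<^bsub>poly_ring V\<^esub>}"
        by (auto simp: Units_def)
    next
      fix x assume x: "x \<in> ?K - {\<zero>\<^bsub>poly_ring V\<^esub>}"
      then obtain c where c: "x = Poly_Mapping.single 0 c" by auto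
      moreover from this x have "c \<noteq> 0" by auto
      ultimately show "x \<in> Units (poly_ring V\<lparr>carrier := ?K\<rparr>)"
        by (auto simp: Units_def mult_single intro!: exI[of _ "inverse c"])
    qed
  qed
qed

text \<open>Classes of monomials outside the ideal are linearly independent: a nonzero combination of them has
  a term outside the ideal. The induction adds the basis vectors one at a time, in the form
  in which \<^term>\<open>ring.dimension\<close> is defined.\<close>

lemma dimension_quot_span:
  assumes "finite B" "B \<subseteq> monomials V - multiples V L"
  defines "I \<equiv> mono_span (multiples V L)"
  shows "ring.dimension (poly_ring V Quot I) (card B) (quot_scalars V I)
    ((\<lambda>f. I +>\<^bsub>poly_ring V\<^esub> f) ` mono_span B)"
proof -
  interpret cring "poly_ring V" by (rule poly_ring_cring)
  interpret I: ideal I "poly_ring V"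
    unfolding I_def by (rule mono_span_multiples_ideal)
  interpret Q: ring "poly_ring V Quot I" by (rule I.quotient_is_ring)
  interpret h: ring_hom_ring "poly_ring V" "poly_ring V Quot I" "\<lambda>f. I +>\<^bsub>poly_ring V\<^esub> f"
    by (rule I.rcos_ring_hom_ring)
  note rcos_add = h.hom_add[simplified] and rcos_mult = h.hom_mult[simplified]
  show ?thesis using assms(1,2)
  proof (induction B rule: finite_induct)
    case empty
    have "mono_span {} = {0 :: 'a cpoly}" by (auto simp: mono_span_def)
    moreover have "I +>\<^bsub>poly_ring V\<^esub> 0 = \<zero>\<^bsub>poly_ring V Quot I\<^esub>" using h.hom_zero by simp
    ultimately show ?case using Q.zero_dim by simp
  next
    case (insert b B)
    let ?E = "(\<lambda>f. I +>\<^bsub>poly_ring V\<^esub> f) ` mono_span B"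
    let ?v = "I +>\<^bsub>poly_ring V\<^esub> Poly_Mapping.single b 1"
    have span_B: "g \<in> mono_span (monomials V)" if "g \<in> mono_span B" for g
      using that insert.prems mono_span_mono[of B "monomials V"] by auto
    have b: "Poly_Mapping.single b c \<in> mono_span (monomials V)" for c :: complex
      using insert.prems by simp
    have "?v \<notin> ?E"
    proof
      assume "?v \<in> ?E"
      then obtain g where g: "g \<in> mono_span B" "?v = I +>\<^bsub>poly_ring V\<^esub> g" by auto
      then have "Poly_Mapping.single b 1 - g \<in> I"
        using quotient_eq_iff_same_a_r_cos[OF I.is_ideal, of "Poly_Mapping.single b 1" g] b span_B
        by (simp del: mono_span_single_iff)
      moreover have "Poly_Mapping.lookup g b = 0"
        using g(1) insert.hyps not_in_keys_iff_lookup_eq_zero[of b g]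
        unfolding mono_span_def by blast
      then have "b \<in> Poly_Mapping.keys (Poly_Mapping.single b 1 - g)"
        by (simp add: in_keys_iff lookup_minus)
      ultimately show False using insert.prems by (auto simp: I_def mono_span_def)
    qed
    moreover have "?v \<in> carrier (poly_ring V Quot I)"
      using h.hom_closed b by (simp del: mono_span_single_iff)
    ultimately have "Q.dimension (Suc (card B)) (quot_scalars V I)
        (Q.line_extension (quot_scalars V I) ?v ?E)"
      using insert.IH insert.prems by (intro Q.Suc_dim) auto
    moreover have "Q.line_extension (quot_scalars V I) ?v ?E =
        (\<lambda>f. I +>\<^bsub>poly_ring V\<^esub> f) ` mono_span (insert b B)"
    proof -
      have step: "(I +>\<^bsub>poly_ring V\<^esub> Poly_Mapping.single 0 c) \<otimes>\<^bsub>poly_ring V Quot I\<^esub> ?v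
          \<oplus>\<^bsub>poly_ring V Quot I\<^esub> (I +>\<^bsub>poly_ring V\<^esub> g) =
          I +>\<^bsub>poly_ring V\<^esub> (Poly_Mapping.single b c + g)" if "g \<in> mono_span B" for c g
      proof -
        have "Poly_Mapping.single 0 c * Poly_Mapping.single b 1 = Poly_Mapping.single b c"
          by (simp add: mult_single)
        then show ?thesis
          using rcos_mult[of "Poly_Mapping.single 0 c" "Poly_Mapping.single b 1"]
            rcos_add[of "Poly_Mapping.single b c" g] insert.prems span_B[OF that] by simp
      qed
      have "mono_span (insert b B) = {Poly_Mapping.single b c + g | c g. g \<in> mono_span B}"
      proof (intro equalityI subsetI)
        fix f assume f: "f \<in> mono_span (insert b B)"
        have "f - Poly_Mapping.single b (Poly_Mapping.lookup f b) \<in> mono_span B"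
          using f by (auto simp: mono_span_def in_keys_iff lookup_minus lookup_single when_def
              split: if_splits)
        then show "f \<in> {Poly_Mapping.single b c + g | c g. g \<in> mono_span B}"
          by (intro CollectI exI conjI) auto
      qed (use mono_span_mono[of B "insert b B"] in \<open>auto intro!: mono_span_add\<close>)
      then have "(\<lambda>f. I +>\<^bsub>poly_ring V\<^esub> f) ` mono_span (insert b B) =
          {I +>\<^bsub>poly_ring V\<^esub> (Poly_Mapping.single b c + g) | c g. g \<in> mono_span B}"
        by auto
      also have "\<dots> = Q.line_extension (quot_scalars V I) ?v ?E"
      proof (rule Set.set_eqI)
        fix x
        have "x \<in> Q.line_extension (quot_scalars V I) ?v ?E \<longleftrightarrow>
            (\<exists>c. \<exists>g\<in>mono_span B. x = (I +>\<^bsub>poly_ring V\<^esub> Poly_Mapping.single 0 c)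
              \<otimes>\<^bsub>poly_ring V Quot I\<^esub> ?v \<oplus>\<^bsub>poly_ring V Quot I\<^esub> (I +>\<^bsub>poly_ring V\<^esub> g))"
          unfolding Q.line_extension_mem_iff quot_scalars_def by blast
        then show "x \<in> {I +>\<^bsub>poly_ring V\<^esub> (Poly_Mapping.single b c + g) | c g. g \<in> mono_span B} \<longleftrightarrow>
            x \<in> Q.line_extension (quot_scalars V I) ?v ?E"
          using step by (simp cong: bex_cong) blast
      qed
      finally show ?thesis by simp
    qed
    ultimately show ?case using insert.hyps by simp
  qed
qed

lemma quot_component_std:
  "quot_component V (mono_span (multiples V L)) d =
   (\<lambda>f. mono_span (multiples V L) +>\<^bsub>poly_ring V\<^esub> f) `
      mono_span {m \<in> monomials V - multiples V L. mdeg m = d}" (is "_ = ?h ` mono_span ?B")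
proof -
  interpret cring "poly_ring V" by (rule poly_ring_cring)
  interpret I: ideal "mono_span (multiples V L)" "poly_ring V"
    by (rule mono_span_multiples_ideal)
  have "?h f \<in> ?h ` mono_span ?B"
    if f: "f \<in> mono_span (monomials V)" "\<forall>m\<in>Poly_Mapping.keys f. mdeg m = d" for f
  proof -
    \<comment> \<open>the normal form of \<^term>\<open>f\<close>: its terms that lie in the ideal are dropped\<close>
    define g where "g = (\<Sum>m\<in>Poly_Mapping.keys f - multiples V L.
      Poly_Mapping.single m (Poly_Mapping.lookup f m))"
    have lookup_g: "Poly_Mapping.lookup g m =
        (if m \<in> multiples V L then 0 else Poly_Mapping.lookup f m)" for m
      by (simp add: g_def lookup_sum lookup_single when_def in_keys_iff)
    have "f - g \<in> mono_span (multiples V L)"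
      by (auto simp: mono_span_def in_keys_iff lookup_minus lookup_g split: if_splits)
    moreover have "g \<in> mono_span ?B"
      using f by (auto simp: mono_span_def in_keys_iff lookup_g split: if_splits)
    moreover from this have "g \<in> mono_span (monomials V)"
      using mono_span_mono[of ?B "monomials V"] by auto
    ultimately show ?thesis
      using quotient_eq_iff_same_a_r_cos[OF I.is_ideal, of f g] f by auto
  qed
  moreover have "mono_span ?B \<subseteq> {f \<in> mono_span (monomials V). \<forall>m\<in>Poly_Mapping.keys f. mdeg m = d}"
    by (auto simp: mono_span_def)
  ultimately show ?thesis
    unfolding quot_component_def poly_ring_simps by blast
qed

text \<open>The standard monomials, those outside the ideal, form a homogeneous basis of the quotient. The
  assumption \<^term>\<open>0 \<notin> L\<close> keeps \<^term>\<open>1\<close> out of the ideal; otherwise the quotient is the zero ring and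
  the constants are not embedded in it as a field.\<close>

lemma hilbert_series_mono_ideal:
  assumes "L \<subseteq> monomials V" "0 \<notin> L"
    and fin: "\<And>d. finite {m \<in> monomials V - multiples V L. mdeg m = d}"
  shows "hilbert_series V (mono_ideal V L) =
    Abs_fps (\<lambda>d. of_nat (card {m \<in> monomials V - multiples V L. mdeg m = d}))"
proof -
  let ?I = "mono_span (multiples V L)"
  interpret cring "poly_ring V" by (rule poly_ring_cring)
  interpret I: ideal ?I "poly_ring V" by (rule mono_span_multiples_ideal)
  interpret Q: ring "poly_ring V Quot ?I" by (rule I.quotient_is_ring)
  interpret h: ring_hom_ring "poly_ring V" "poly_ring V Quot ?I" "\<lambda>f. ?I +>\<^bsub>poly_ring V\<^esub> f"
    by (rule I.rcos_ring_hom_ring)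
  have "0 \<notin> multiples V L"
    using assms(2) mono_dvd_antisym[of _ 0] unfolding multiples_def mono_dvd_def
    by (fastforce simp: mono_dvd_def)
  then have "1 \<notin> ?I" by simp
  then have "\<one>\<^bsub>poly_ring V Quot ?I\<^esub> \<noteq> \<zero>\<^bsub>poly_ring V Quot ?I\<^esub>"
    using quotient_eq_iff_same_a_r_cos[OF I.is_ideal, of 1 0] h.hom_one h.hom_zero one_closed
    by simp
  then have "subfield (quot_scalars V ?I) (poly_ring V Quot ?I)"
    using h.img_is_subfield(2)[OF constants_subfield] by (simp add: quot_scalars_def image_image)
  then have "Q.dim (quot_scalars V ?I) (quot_component V ?I d) =
      card {m \<in> monomials V - multiples V L. mdeg m = d}" for d
    using Q.dimI dimension_quot_span[OF fin[of d]] unfolding over_def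
    by (fastforce simp: quot_component_std)
  then show ?thesis
    by (simp add: hilbert_series_def mono_ideal_eq_span[OF assms(1)])
qed

section \<open>Variables and products of two variables\<close>

lemma lookup_var: "Poly_Mapping.lookup (var v) w = (if w = v then 1 else 0)"
  by (simp add: var_def lookup_single when_def)

lemma keys_var [simp]: "Poly_Mapping.keys (var v) = {v}"
  by (simp add: var_def)

lemma var_in_monomials [simp]: "var v \<in> monomials V \<longleftrightarrow> v \<in> V"
  by (simp add: monomials_def)

lemma mdeg_var [simp]: "mdeg (var v) = 1"
  by (simp add: mdeg_def lookup_var)

lemma mdeg_var_var [simp]: "mdeg (var u + var v) = 2"
  by (cases "u = v") (auto simp: mdeg_def keys_add_monomial lookup_add lookup_var)

lemma var_inject [simp]: "var u = var v \<longleftrightarrow> u = v"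
  using keys_var by (metis singleton_inject)

lemma var_neq_var_var [simp]: "var w \<noteq> var u + var v" "var u + var v \<noteq> var w"
  by (auto dest!: arg_cong[of "var _" _ mdeg] arg_cong[of "var _ + var _" _ mdeg])

lemma var_var_eq_iff: "var u + var v = var a + var b \<longleftrightarrow> u = a \<and> v = b \<or> u = b \<and> v = a"
proof
  assume "var u + var v = var a + var b"
  then have "Poly_Mapping.keys (var u + var v) = Poly_Mapping.keys (var a + var b)" by simp
  then show "u = a \<and> v = b \<or> u = b \<and> v = a"
    by (simp add: keys_add_monomial insert_commute doubleton_eq_iff)
qed (auto simp: add.commute)

lemma var_dvd_iff: "mono_dvd (var v) m \<longleftrightarrow> v \<in> Poly_Mapping.keys m"
  by (auto simp: mono_dvd_def lookup_var in_keys_iff Suc_le_eq)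

lemma square_dvd_iff: "mono_dvd (var v + var v) m \<longleftrightarrow> 2 \<le> Poly_Mapping.lookup m v"
  by (auto simp: mono_dvd_def lookup_var lookup_add)

lemma var_var_dvd_iff:
  "u \<noteq> v \<Longrightarrow> mono_dvd (var u + var v) m \<longleftrightarrow> u \<in> Poly_Mapping.keys m \<and> v \<in> Poly_Mapping.keys m"
  by (auto simp: mono_dvd_def lookup_var lookup_add in_keys_iff Suc_le_eq)

section \<open>Generators of an induced subgraph\<close>

text \<open>The independence polynomial of the subgraph induced on \<^term>\<open>A\<close>. It is a power series because this is
  the type of the results of the algorithm.\<close>

definition indep_poly :: "('v \<times> 'v) set \<Rightarrow> 'v set \<Rightarrow> rat fps" where
  "indep_poly E A = Abs_fps (\<lambda>k. of_nat (card {S. independent_set A E S \<and> card S = k}))"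

locale simple_graph =
  fixes V :: "'v set" and E :: "('v \<times> 'v) set"
  assumes finite_V: "finite V" and E_subset: "E \<subseteq> V \<times> V" and sym_E: "sym E" and irrefl_E: "irrefl E"
begin

text \<open>The state of the algorithm when \<^term>\<open>A\<close> is the set of nodes still in the graph: a removed node
  contributes its variable, so that no standard monomial involves it, and the nodes of \<^term>\<open>A\<close>
  contribute the generators of the modified edge ideal of the induced subgraph.\<close>

definition live_gens :: "'v set \<Rightarrow> 'v monomial set" where
  "live_gens A = var ` (V - A) \<union> (\<lambda>v. var v + var v) ` A \<union>
     (\<lambda>(u, v). var u + var v) ` (E \<inter> A \<times> A)"

definition nbrs :: "'v \<Rightarrow> 'v set" where
  "nbrs v = {u. (v, u) \<in> E}"

lemma edge_commute: "(u, v) \<in> E \<longleftrightarrow> (v, u) \<in> E"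
  using sym_E by (auto dest: symD)

lemma edge_neq: "(u, v) \<in> E \<Longrightarrow> u \<noteq> v"
  using irrefl_E by (auto simp: irrefl_def)

lemma live_gens_cases [consumes 1, case_names dead square edge]:
  assumes "m \<in> live_gens A"
  obtains v where "v \<in> V" "v \<notin> A" "m = var v"
  | v where "v \<in> A" "m = var v + var v"
  | u v where "(u, v) \<in> E" "u \<in> A" "v \<in> A" "u \<noteq> v" "m = var u + var v"
  using assms edge_neq by (auto simp: live_gens_def)

lemma bex_live_gens:
  "(\<exists>m\<in>live_gens A. Q m) \<longleftrightarrow> (\<exists>v\<in>V - A. Q (var v)) \<or> (\<exists>v\<in>A. Q (var v + var v)) \<or>
    (\<exists>u\<in>A. \<exists>v\<in>A. (u, v) \<in> E \<and> Q (var u + var v))"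
proof -
  have "(\<exists>m\<in>(\<lambda>(u, v). var u + var v) ` (E \<inter> A \<times> A). Q m) \<longleftrightarrow>
      (\<exists>u\<in>A. \<exists>v\<in>A. (u, v) \<in> E \<and> Q (var u + var v))"
    by (simp add: Bex_def) blast
  then show ?thesis by (simp add: live_gens_def bex_Un)
qed

lemma square_in_live_gens: "var v + var v \<in> live_gens A \<longleftrightarrow> v \<in> A"
  using edge_neq by (auto simp: live_gens_def var_var_eq_iff)

lemma var_var_in_live_gens:
  "u \<noteq> v \<Longrightarrow> var u + var v \<in> live_gens A \<longleftrightarrow> (u, v) \<in> E \<and> u \<in> A \<and> v \<in> A"
  using edge_commute by (auto simp: live_gens_def var_var_eq_iff intro!: image_eqI[of _ _ "(u, v)"])

lemma live_gens_subset: "A \<subseteq> V \<Longrightarrow> live_gens A \<subseteq> monomials V"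
  by (auto simp: live_gens_def)

lemma finite_live_gens: "A \<subseteq> V \<Longrightarrow> finite (live_gens A)"
  using finite_V finite_subset[OF E_subset] finite_subset[of A V] by (auto simp: live_gens_def)

lemma zero_not_in_live_gens: "0 \<notin> live_gens A"
proof
  assume "0 \<in> live_gens A"
  then show False
    by (cases rule: live_gens_cases)
      (metis keys_add_monomial keys_var keys_zero insert_not_empty sup_eq_bot_iff)+
qed

lemma edge_gens_eq: "edge_gens V E = live_gens V"
  using E_subset by (auto simp: edge_gens_def live_gens_def)

lemma modified_edge_ideal_eq: "modified_edge_ideal V E = mono_ideal V (live_gens V)"
proof -
  have "{var u + var v | u v. (u, v) \<in> E} \<subseteq> monomials V" "{var v + var v | v. v \<in> V} \<subseteq> monomials V"
    using E_subset by auto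
  then show ?thesis
    unfolding modified_edge_ideal_def edge_gens_eq[symmetric] edge_gens_def by (rule mono_ideal_sum)
qed

lemma live_gens_antichain:
  assumes "l \<in> live_gens A" "m \<in> live_gens A" "mono_dvd l m"
  shows "l = m"
  using assms(1)
proof (cases rule: live_gens_cases)
  case (dead v)
  with assms(2,3) show ?thesis
    by (cases rule: live_gens_cases) (auto simp: var_dvd_iff keys_add_monomial)
next
  case (square v)
  from assms(2) show ?thesis
    by (cases rule: live_gens_cases)
      (use assms(3) square in \<open>auto simp: square_dvd_iff lookup_add lookup_var split: if_splits\<close>)
next
  case (edge u v)
  from assms(2) show ?thesis
    by (cases rule: live_gens_cases)
      (use assms(3) edge in \<open>auto simp: var_var_dvd_iff keys_add_monomial add.commute\<close>)
qed

lemma min_gens_live_gens: "A \<subseteq> V \<Longrightarrow> is_min_gens V (mono_ideal V (live_gens A)) (live_gens A)"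
  by (intro is_min_gens_antichain finite_live_gens live_gens_subset live_gens_antichain)

lemma min_gens_live_gens_iff:
  "A \<subseteq> V \<Longrightarrow> is_min_gens V (mono_ideal V (live_gens A)) C \<longleftrightarrow> C = live_gens A"
  using min_gens_live_gens min_gens_unique by blast

lemma nodes_of_live_gens: "A \<subseteq> V \<Longrightarrow> nodes_of V (live_gens A) = A"
  by (auto simp: nodes_of_def square_in_live_gens)

lemma edges_of_live_gens: "A \<subseteq> V \<Longrightarrow> edges_of V (live_gens A) = E \<inter> A \<times> A"
  using E_subset edge_neq by (auto simp: edges_of_def var_var_in_live_gens)

lemma only_vars_and_squares_live_gens:
  assumes "A \<subseteq> V"
  shows "only_vars_and_squares V (live_gens A) \<longleftrightarrow> E \<inter> A \<times> A = {}"
proof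
  assume only: "only_vars_and_squares V (live_gens A)"
  have False if "(u, v) \<in> E" "u \<in> A" "v \<in> A" for u v
  proof -
    have "var u + var v \<in> live_gens A" using that edge_neq by (simp add: var_var_in_live_gens)
    with only obtain w where "var u + var v = var w + var w"
      unfolding only_vars_and_squares_def by fastforce
    with edge_neq[OF that(1)] show False by (auto simp: var_var_eq_iff)
  qed
  then show "E \<inter> A \<times> A = {}" by auto
next
  assume "E \<inter> A \<times> A = {}"
  with assms show "only_vars_and_squares V (live_gens A)"
    by (auto simp: only_vars_and_squares_def live_gens_def)
qed

lemma independent_set_induced: "independent_set A (E \<inter> A \<times> A) S \<longleftrightarrow> independent_set A E S"
  by (auto simp: independent_set_def pairwise_def)

text \<open>The three kinds of generators exclude the three ways in which a monomial can fail to be the product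
  of the variables of an independent set: a removed variable, an exponent above one,
  and an edge inside the support.\<close>

lemma not_multiple_live_gens_iff:
  assumes "A \<subseteq> V" "m \<in> monomials V"
  shows "m \<notin> multiples V (live_gens A) \<longleftrightarrow>
    independent_set A E (Poly_Mapping.keys m) \<and> (\<forall>v. Poly_Mapping.lookup m v \<le> 1)"
proof -
  have edge_dvd: "(u, v) \<in> E \<and> mono_dvd (var u + var v) m \<longleftrightarrow>
      (u, v) \<in> E \<and> u \<in> Poly_Mapping.keys m \<and> v \<in> Poly_Mapping.keys m" for u v
    using edge_neq[of u v] var_var_dvd_iff[of u v m] by auto
  have "m \<notin> multiples V (live_gens A) \<longleftrightarrow>
      (\<forall>v\<in>V - A. v \<notin> Poly_Mapping.keys m) \<and> (\<forall>v\<in>A. \<not> 2 \<le> Poly_Mapping.lookup m v) \<and>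
      (\<forall>u\<in>A. \<forall>v\<in>A. \<not> ((u, v) \<in> E \<and> u \<in> Poly_Mapping.keys m \<and> v \<in> Poly_Mapping.keys m))"
    (is "_ \<longleftrightarrow> ?dead \<and> ?square \<and> ?edge")
    using assms(2)
    by (simp only: multiples_def mem_Collect_eq bex_live_gens var_dvd_iff square_dvd_iff edge_dvd
        de_Morgan_disj bex_simps(8) simp_thms)
  moreover have "?dead \<longleftrightarrow> Poly_Mapping.keys m \<subseteq> A"
    using assms unfolding monomials_def by blast
  moreover have "?square \<longleftrightarrow> (\<forall>v. Poly_Mapping.lookup m v \<le> 1)" if "Poly_Mapping.keys m \<subseteq> A"
  proof -
    have "Poly_Mapping.lookup m v \<le> 1 \<longleftrightarrow> v \<notin> A \<or> \<not> 2 \<le> Poly_Mapping.lookup m v" for v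
      using that in_keys_iff[of v m] by fastforce
    then show ?thesis by blast
  qed
  moreover have "?edge \<longleftrightarrow> pairwise (\<lambda>u v. (u, v) \<notin> E) (Poly_Mapping.keys m)"
    if "Poly_Mapping.keys m \<subseteq> A"
    using that edge_neq unfolding pairwise_def by blast
  ultimately show ?thesis unfolding independent_set_def by argo
qed

section \<open>Colon, sum and node deletion\<close>

text \<open>The reason why the colon ideal removes the neighbours of \<^term>\<open>v\<close> along with \<^term>\<open>v\<close>.\<close>

lemma independent_set_insert:
  assumes "v \<in> A"
  shows "independent_set A E (insert v S) \<and> v \<notin> S \<longleftrightarrow> independent_set (A - {v} - nbrs v) E S"
proof -
  have pairwise: "pairwise (\<lambda>u w. (u, w) \<notin> E) (insert v S) \<longleftrightarrow>
      pairwise (\<lambda>u w. (u, w) \<notin> E) S \<and> (\<forall>u\<in>S. u \<noteq> v \<longrightarrow> u \<notin> nbrs v)"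
    using edge_commute unfolding pairwise_insert nbrs_def by blast
  show ?thesis unfolding independent_set_def pairwise using assms by auto
qed

text \<open>A monomial \<^term>\<open>m\<close> lies outside the colon ideal iff \<^term>\<open>m + var v\<close> is standard, that is, iff \<^term>\<open>m\<close> is
  the product over an independent set that avoids \<^term>\<open>v\<close> and its neighbours.\<close>

lemma colon_live_gens:
  assumes "A \<subseteq> V" "v \<in> A"
  shows "colon_ideal V (mono_ideal V (live_gens A)) (monom_poly (var v)) =
    mono_ideal V (live_gens (A - {v} - nbrs v))"
proof -
  have "m + var v \<notin> multiples V (live_gens A) \<longleftrightarrow> m \<notin> multiples V (live_gens (A - {v} - nbrs v))"
    if m: "m \<in> monomials V" for m
  proof -
    have "Poly_Mapping.lookup (m + var v) w \<le> 1 \<longleftrightarrow>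
        Poly_Mapping.lookup m w \<le> 1 \<and> (w = v \<longrightarrow> v \<notin> Poly_Mapping.keys m)" for w
      by (auto simp: lookup_add lookup_var in_keys_iff)
    then have "(\<forall>w. Poly_Mapping.lookup (m + var v) w \<le> 1) \<longleftrightarrow>
        (\<forall>w. Poly_Mapping.lookup m w \<le> 1) \<and> v \<notin> Poly_Mapping.keys m"
      by blast
    moreover have "independent_set A E (Poly_Mapping.keys (m + var v)) \<and> v \<notin> Poly_Mapping.keys m \<longleftrightarrow>
        independent_set (A - {v} - nbrs v) E (Poly_Mapping.keys m)"
      using independent_set_insert[OF assms(2), of "Poly_Mapping.keys m"]
      by (simp add: keys_add_monomial)
    moreover have "m + var v \<in> monomials V" "A - {v} - nbrs v \<subseteq> V" using m assms by auto
    note not_multiple_live_gens_iff[OF assms(1) this(1)] not_multiple_live_gens_iff[OF this(2) m]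
    ultimately show ?thesis by argo
  qed
  then have "{m \<in> monomials V. m + var v \<in> multiples V (live_gens A)} =
      multiples V (live_gens (A - {v} - nbrs v))"
    using multiples_subset[of V] by blast
  moreover have "A - {v} - nbrs v \<subseteq> V" "v \<in> V" using assms by auto
  ultimately show ?thesis
    using assms by (simp add: colon_ideal_span mono_ideal_eq_span[symmetric] live_gens_subset)
qed

text \<open>The new generator discards exactly the standard monomials that involve \<^term>\<open>v\<close>.\<close>

lemma plus_live_gens:
  assumes "A \<subseteq> V" "v \<in> A"
  shows "mono_ideal V (insert (var v) (live_gens A)) = mono_ideal V (live_gens (A - {v}))"
proof -
  have "m \<in> multiples V (insert (var v) (live_gens A)) \<longleftrightarrow> m \<in> multiples V (live_gens (A - {v}))"
    if m: "m \<in> monomials V" for m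
  proof -
    have "m \<notin> multiples V (insert (var v) (live_gens A)) \<longleftrightarrow>
        v \<notin> Poly_Mapping.keys m \<and> m \<notin> multiples V (live_gens A)"
      using m by (auto simp: multiples_def var_dvd_iff)
    moreover have "v \<notin> Poly_Mapping.keys m \<and> independent_set A E (Poly_Mapping.keys m) \<longleftrightarrow>
        independent_set (A - {v}) E (Poly_Mapping.keys m)"
      by (auto simp: independent_set_def)
    moreover have "A - {v} \<subseteq> V" using assms by auto
    note not_multiple_live_gens_iff[OF assms(1) m] not_multiple_live_gens_iff[OF this m]
    ultimately show ?thesis by argo
  qed
  then have "multiples V (insert (var v) (live_gens A)) = multiples V (live_gens (A - {v}))"
    using multiples_subset[of V] by blast
  moreover have "A - {v} \<subseteq> V" "v \<in> V" using assms by auto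
  ultimately show ?thesis
    using assms live_gens_subset by (subst mono_ideal_eq_iff) auto
qed

text \<open>Both recursive calls are again made on lists of the form \<^term>\<open>live_gens\<close>, so every branch of
  a run is a sequence of node deletions. Colon and Plus are known exactly, because minimal
  monomial generators are unique.\<close>

lemma S_split_live_gens_iff:
  assumes "A \<subseteq> V"
  shows "S_split V (live_gens A) v C P \<longleftrightarrow> E \<inter> A \<times> A \<noteq> {} \<and> v \<in> A \<and>
    C = live_gens (A - {v} - nbrs v) \<and> P = live_gens (A - {v})"
proof -
  have sub: "A - {v} - nbrs v \<subseteq> V" "A - {v} \<subseteq> V" using assms by auto
  show ?thesis
    using assms sub unfolding S_split_def only_vars_and_squares_live_gens[OF assms] square_in_live_gens
    by (auto simp: colon_live_gens plus_live_gens min_gens_live_gens_iff)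
qed

section \<open>Independent sets and the independence polynomial\<close>

text \<open>Standard monomials are squarefree, so they are determined by their supports, and their degree is
  the size of the support.\<close>

lemma bij_betw_standard_monomials:
  assumes "A \<subseteq> V"
  shows "bij_betw Poly_Mapping.keys {m \<in> monomials V - multiples V (live_gens A). mdeg m = d}
    {S. independent_set A E S \<and> card S = d}"
proof -
  have mdeg: "mdeg m = card (Poly_Mapping.keys m)" if "\<forall>v. Poly_Mapping.lookup m v \<le> 1"
    for m :: "'v monomial"
  proof -
    have "Poly_Mapping.lookup m v = 1" if "v \<in> Poly_Mapping.keys m" for v
      using that \<open>\<forall>v. Poly_Mapping.lookup m v \<le> 1\<close>[rule_format, of v] by (simp add: in_keys_iff)
    then show ?thesis by (simp add: mdeg_def)
  qed
  let ?B = "{m. independent_set A E (Poly_Mapping.keys m) \<and> (\<forall>v. Poly_Mapping.lookup m v \<le> 1) \<and>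
    mdeg m = d}"
  have B: "{m \<in> monomials V - multiples V (live_gens A). mdeg m = d} = ?B"
    using not_multiple_live_gens_iff[OF assms] assms by (auto simp: independent_set_def monomials_def)
  have "inj_on Poly_Mapping.keys ?B"
  proof (rule inj_onI)
    fix m k assume "m \<in> ?B" "k \<in> ?B" and keys: "Poly_Mapping.keys m = Poly_Mapping.keys k"
    then have le: "\<And>v. Poly_Mapping.lookup m v \<le> 1" "\<And>v. Poly_Mapping.lookup k v \<le> 1" by auto
    show "m = k"
    proof (rule poly_mapping_eqI)
      fix v show "Poly_Mapping.lookup m v = Poly_Mapping.lookup k v"
        using le[of v] keys in_keys_iff[of v m] in_keys_iff[of v k] by fastforce
    qed
  qed
  moreover have "S \<in> Poly_Mapping.keys ` ?B" if S: "independent_set A E S" "card S = d" for S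
  proof -
    have fin: "finite S"
      using S assms finite_V by (auto simp: independent_set_def intro: finite_subset)
    define m where "m = (\<Sum>v\<in>S. var v)"
    have lookup: "Poly_Mapping.lookup m v = (if v \<in> S then 1 else 0)" for v
      using fin by (simp add: m_def lookup_sum lookup_var)
    then have "Poly_Mapping.keys m = S" by (auto simp: in_keys_iff split: if_splits)
    with S lookup mdeg[of m] show ?thesis by (intro image_eqI[of _ _ m]) auto
  qed
  ultimately show ?thesis
    unfolding B bij_betw_def by (auto simp: mdeg)
qed

lemma finite_independent_sets: "A \<subseteq> V \<Longrightarrow> finite {S. independent_set A E S \<and> Q S}"
  by (rule finite_subset[of _ "Pow V"]) (auto simp: independent_set_def finite_V)

lemma hilbert_series_live_gens:
  assumes "A \<subseteq> V"
  shows "hilbert_series V (mono_ideal V (live_gens A)) = indep_poly E A"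
  using hilbert_series_mono_ideal[OF live_gens_subset[OF assms] zero_not_in_live_gens]
    bij_betw_finite[OF bij_betw_standard_monomials[OF assms]]
    bij_betw_same_card[OF bij_betw_standard_monomials[OF assms]] finite_independent_sets[OF assms]
  by (simp add: indep_poly_def)

lemma independent_sets_with:
  assumes "A \<subseteq> V" "v \<in> A"
  shows "card {S. independent_set A E S \<and> v \<in> S \<and> card S = k + 1} =
    card {S. independent_set (A - {v} - nbrs v) E S \<and> card S = k}"
proof (rule bij_betw_same_card[symmetric])
  have "finite A" using assms(1) finite_V by (rule finite_subset)
  then have fin: "finite S" if "independent_set A E S" for S
    using that by (auto simp: independent_set_def intro: finite_subset)
  have insert: "independent_set A E (insert v S)" "v \<notin> S" "finite S"
    if "independent_set (A - {v} - nbrs v) E S" for S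
    using that independent_set_insert[OF assms(2), of S] fin[of "insert v S"] by auto
  have remove: "independent_set (A - {v} - nbrs v) E (S - {v})"
    if "independent_set A E S" "v \<in> S" for S
    using that independent_set_insert[OF assms(2), of "S - {v}"] by (simp add: insert_absorb)
  show "bij_betw (insert v) {S. independent_set (A - {v} - nbrs v) E S \<and> card S = k}
      {S. independent_set A E S \<and> v \<in> S \<and> card S = k + 1}"
  proof (rule bij_betw_byWitness[where f' = "\<lambda>S. S - {v}"])
    show "insert v ` {S. independent_set (A - {v} - nbrs v) E S \<and> card S = k} \<subseteq>
        {S. independent_set A E S \<and> v \<in> S \<and> card S = k + 1}"
      using insert by auto
    show "(\<lambda>S. S - {v}) ` {S. independent_set A E S \<and> v \<in> S \<and> card S = k + 1} \<subseteq>
        {S. independent_set (A - {v} - nbrs v) E S \<and> card S = k}"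
      using remove fin by auto
  qed (auto simp: independent_set_def)
qed

lemma independent_sets_without:
  "{S. independent_set A E S \<and> v \<notin> S \<and> card S = k} = {S. independent_set (A - {v}) E S \<and> card S = k}"
  by (auto simp: independent_set_def)

lemma indep_poly_rec:
  assumes "A \<subseteq> V" "v \<in> A"
  shows "indep_poly E A = fps_X * indep_poly E (A - {v} - nbrs v) + indep_poly E (A - {v})"
proof (rule fps_ext)
  fix k
  have "card {S. independent_set A E S \<and> card S = k} =
      card ({S. independent_set A E S \<and> v \<in> S \<and> card S = k} \<union>
            {S. independent_set A E S \<and> v \<notin> S \<and> card S = k})"
    by (rule arg_cong[of _ _ card]) auto
  also have "\<dots> = card {S. independent_set A E S \<and> v \<in> S \<and> card S = k} +
      card {S. independent_set A E S \<and> v \<notin> S \<and> card S = k}"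
    using finite_independent_sets[OF assms(1)] by (intro card_Un_disjoint) auto
  also have "card {S. independent_set A E S \<and> v \<in> S \<and> card S = k} =
      (if k = 0 then 0 else card {S. independent_set (A - {v} - nbrs v) E S \<and> card S = k - 1})"
  proof (cases k)
    case 0
    have "finite S" if "independent_set A E S" for S
      using that assms finite_V by (auto simp: independent_set_def intro: finite_subset)
    then have "{S. independent_set A E S \<and> v \<in> S \<and> card S = 0} = {}" unfolding 0 by (auto simp: card_gt_0_iff)
    then show ?thesis unfolding 0 by (simp only: card.empty if_True refl)
  next
    case (Suc j)
    then show ?thesis using independent_sets_with[OF assms, of j] by simp
  qed
  finally show "fps_nth (indep_poly E A) k =
      fps_nth (fps_X * indep_poly E (A - {v} - nbrs v) + indep_poly E (A - {v})) k"
    by (simp add: indep_poly_def independent_sets_without)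
qed

lemma indep_poly_edgeless:
  assumes "A \<subseteq> V" "E \<inter> A \<times> A = {}"
  shows "indep_poly E A = (1 + fps_X) ^ card A"
proof (rule fps_ext)
  fix k
  have "{S. independent_set A E S \<and> card S = k} = {S. S \<subseteq> A \<and> card S = k}"
    using assms(2) by (auto simp: independent_set_def pairwise_def)
  moreover have "finite A" using assms(1) finite_V by (rule finite_subset)
  ultimately show "fps_nth (indep_poly E A) k = fps_nth ((1 + fps_X) ^ card A) k"
    by (simp add: indep_poly_def n_subsets fps_binomial_of_nat[symmetric] binomial_gbinomial)
qed

section \<open>Comparison with the general algorithm\<close>

text \<open>Each node counts once if it is removed and twice if it is live, and each live edge counts twice. So the
  total degree drops whenever a live node is removed, which is the condition that the
  general algorithm puts on its pivots.\<close>

lemma sum_deg_live_gens: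
  assumes "A \<subseteq> V"
  shows "sum_deg (live_gens A) =
    card V + card A + 2 * card ((\<lambda>(u, v). var u + var v) ` (E \<inter> A \<times> A))"
proof -
  have fin: "finite V" "finite A" "finite E"
    using assms finite_V finite_subset[OF E_subset] finite_subset by auto
  let ?D = "var ` (V - A)" and ?S = "(\<lambda>v. var v + var v) ` A"
    and ?E = "(\<lambda>(u, v). var u + var v) ` (E \<inter> A \<times> A)"
  have disj: "?D \<inter> ?S = {}" "(?D \<union> ?S) \<inter> ?E = {}"
    by (auto simp: var_var_eq_iff dest: edge_neq)
  have "sum_deg (live_gens A) = sum mdeg ?D + sum mdeg ?S + sum mdeg ?E"
    unfolding sum_deg_def live_gens_def using fin disj by (simp add: sum.union_disjoint)
  also have "sum mdeg ?D = card (V - A)"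
    by (subst sum.reindex) (auto simp: inj_on_def)
  also have "sum mdeg ?S = 2 * card A"
    by (subst sum.reindex) (auto simp: inj_on_def var_var_eq_iff)
  also have "sum mdeg ?E = (\<Sum>m\<in>?E. 2)"
    by (rule sum.cong) auto
  also have "card (V - A) + 2 * card A = card V + card A"
    using fin assms card_mono[of V A] by (simp add: card_Diff_subset)
  finally show ?thesis by simp
qed

lemma sum_deg_live_gens_less:
  assumes "A \<subseteq> V" "B \<subset> A"
  shows "sum_deg (live_gens B) < sum_deg (live_gens A)"
proof -
  have fin: "finite A" "finite E"
    using assms finite_V finite_subset[OF E_subset] finite_subset by auto
  have "card B < card A" using assms fin by (simp add: psubset_card_mono)
  moreover have "card ((\<lambda>(u, v). var u + var v) ` (E \<inter> B \<times> B)) \<le>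
      card ((\<lambda>(u, v). var u + var v) ` (E \<inter> A \<times> A))"
    using fin assms(2) by (intro card_mono image_mono) auto
  ultimately show ?thesis
    using assms by (simp add: sum_deg_live_gens)
qed

text \<open>The two algorithms stop at the same lists: an edge shares a variable with the square of either
  endpoint, while variables and squares belong to distinct nodes.\<close>

lemma pairwise_coprime_live_gens_iff:
  assumes "A \<subseteq> V"
  shows "pairwise coprime_monomials (live_gens A) \<longleftrightarrow> E \<inter> A \<times> A = {}"
proof
  assume cop: "pairwise coprime_monomials (live_gens A)"
  have False if "(u, v) \<in> E" "u \<in> A" "v \<in> A" for u v
  proof -
    have "var u + var u \<in> live_gens A" "var u + var v \<in> live_gens A" "u \<noteq> v"
      using that edge_neq by (auto simp: square_in_live_gens var_var_in_live_gens)
    moreover from this have "var u + var u \<noteq> var u + var v" by (simp add: var_var_eq_iff)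
    ultimately have "coprime_monomials (var u + var u) (var u + var v)"
      using cop by (blast dest: pairwiseD)
    then show False by (simp add: coprime_monomials_def keys_add_monomial)
  qed
  then show "E \<inter> A \<times> A = {}" by auto
next
  assume "E \<inter> A \<times> A = {}"
  then show "pairwise coprime_monomials (live_gens A)"
    by (auto simp: live_gens_def pairwise_def coprime_monomials_def keys_add_monomial)
qed

text \<open>Each square contributes \<open>1 - z^2 = (1 + z) (1 - z)\<close>, which turns the numerator returned at a leaf
  of the general algorithm into the power of \<open>1 + z\<close> returned by the specialized one.\<close>

lemma HN_base_live_gens:
  assumes "A \<subseteq> V" "E \<inter> A \<times> A = {}"
  shows "(\<Prod>m\<in>live_gens A. 1 - fps_X ^ mdeg m) = (1 + fps_X) ^ card A * (1 - fps_X :: rat fps) ^ card V"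
proof -
  have fin: "finite V" "finite A" using assms finite_V finite_subset by auto
  let ?g = "\<lambda>m :: 'v monomial. 1 - fps_X ^ mdeg m :: rat fps"
  have "prod ?g (live_gens A) = prod ?g (var ` (V - A)) * prod ?g ((\<lambda>v. var v + var v) ` A)"
    unfolding live_gens_def assms(2) using fin by (simp, intro prod.union_disjoint) auto
  also have "prod ?g (var ` (V - A)) = (1 - fps_X) ^ card (V - A)"
    by (subst prod.reindex) (auto simp: inj_on_def)
  also have "prod ?g ((\<lambda>v. var v + var v) ` A) = (1 - fps_X ^ 2) ^ card A"
    by (subst prod.reindex) (auto simp: inj_on_def var_var_eq_iff)
  also have "(1 - fps_X ^ 2 :: rat fps) = (1 + fps_X) * (1 - fps_X)"
    by (simp add: algebra_simps power2_eq_square)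
  also have "(1 - fps_X) ^ card (V - A) * ((1 + fps_X) * (1 - fps_X :: rat fps)) ^ card A =
      (1 + fps_X) ^ card A * (1 - fps_X) ^ (card (V - A) + card A)"
    by (simp only: power_mult_distrib power_add mult_ac)
  also have "card (V - A) + card A = card V"
    using fin assms card_mono[of V A] by (simp add: card_Diff_subset)
  finally show ?thesis .
qed

text \<open>The numerator of the corresponding general run is \<^term>\<open>f * (1 - fps_X) ^ card V\<close> throughout. The number of variables of the
  ring does not change in recursive calls, so this factor passes through the
  recursion, in which a pivot of degree one contributes the factor \<^term>\<open>fps_X\<close>.\<close>

lemma S_run_live_gens:
  assumes "S_run V L t f" "L = live_gens A" "A \<subseteq> V"
  shows "f = indep_poly E A \<and> HN_run V L (map_run var t) (f * (1 - fps_X) ^ card V)"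
  using assms
proof (induction arbitrary: A rule: S_run.induct)
  case (base L)
  then have edgeless: "E \<inter> A \<times> A = {}" by (simp add: only_vars_and_squares_live_gens)
  have "{v \<in> V. var v + var v \<in> L} = A"
    using base by (auto simp: square_in_live_gens)
  with base edgeless HN_run.coprime[of L V] show ?case
    by (simp add: indep_poly_edgeless HN_base_live_gens pairwise_coprime_live_gens_iff)
next
  case (split L v C P t1 f1 t2 f2)
  have edge: "E \<inter> A \<times> A \<noteq> {}" and v: "v \<in> A"
    and C: "C = live_gens (A - {v} - nbrs v)" and P: "P = live_gens (A - {v})"
    using split.hyps(1) split.prems by (auto simp: S_split_live_gens_iff)
  have sub: "A - {v} - nbrs v \<subseteq> V" "A - {v} \<subseteq> V" "v \<in> V" using split.prems(2) v by auto
  note IH = split.IH(1)[OF C sub(1)] split.IH(2)[OF P sub(2)]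
  let ?n = "card V"
  have "HN_run V L (Split (var v) (map_run var t1) (map_run var t2))
      (fps_X ^ mdeg (var v) * (f1 * (1 - fps_X) ^ ?n) + f2 * (1 - fps_X) ^ ?n)"
  proof (rule HN_run.pivot)
    show "\<not> pairwise coprime_monomials L"
      using edge split.prems by (simp add: pairwise_coprime_live_gens_iff)
    show "var v \<in> monomials V" using sub by simp
    show "is_min_gens V (colon_ideal V (mono_ideal V L) (monom_poly (var v))) C"
      using split.hyps(1) by (simp add: S_split_def)
    have "mono_ideal V L <+>\<^bsub>poly_ring V\<^esub> mono_ideal V {var v} = mono_ideal V (insert (var v) L)"
      using mono_ideal_sum[of L V "{var v}"] sub live_gens_subset split.prems by simp
    then show "is_min_gens V (mono_ideal V L <+>\<^bsub>poly_ring V\<^esub> mono_ideal V {var v}) P"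
      using split.hyps(1) by (simp add: S_split_def)
    show "sum_deg C < sum_deg L" "sum_deg P < sum_deg L"
      unfolding C P split.prems(1) using split.prems(2) v
      by (auto intro!: sum_deg_live_gens_less)
  qed (use IH in auto)
  then show ?case
    using IH indep_poly_rec[OF split.prems(2) v] by (simp add: algebra_simps)
qed

lemma S_run_exists: "A \<subseteq> V \<Longrightarrow> \<exists>t f. S_run V (live_gens A) t f"
proof (induction "card A" arbitrary: A rule: less_induct)
  case less
  show ?case
  proof (cases "E \<inter> A \<times> A = {}")
    case True
    then show ?thesis using S_run.base only_vars_and_squares_live_gens[OF less.prems] by blast
  next
    case False
    then obtain v where v: "v \<in> A" by auto
    have "finite A" using less.prems finite_V by (rule finite_subset)
    then have "card (A - {v} - nbrs v) < card A" "card (A - {v}) < card A"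
      by (rule psubset_card_mono, use v in blast)+
    then obtain t1 f1 t2 f2 where "S_run V (live_gens (A - {v} - nbrs v)) t1 f1"
      "S_run V (live_gens (A - {v})) t2 f2"
      using less.hyps less.prems by (meson Diff_subset subset_trans)
    moreover have "S_split V (live_gens A) v (live_gens (A - {v} - nbrs v)) (live_gens (A - {v}))"
      using False v by (simp add: S_split_live_gens_iff[OF less.prems])
    ultimately show ?thesis by (intro exI) (rule S_run.split)
  qed
qed

section \<open>Reachable states and termination\<close>

lemma S_call_live_gens:
  assumes "S_call V (live_gens A) L" "A \<subseteq> V"
  obtains B where "B \<subset> A" "L = live_gens B"
proof -
  from assms obtain v where "v \<in> A" "L = live_gens (A - {v} - nbrs v) \<or> L = live_gens (A - {v})"
    by (auto simp: S_call_def S_split_live_gens_iff)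
  then show ?thesis
    using that[of "A - {v} - nbrs v"] that[of "A - {v}"] by blast
qed

lemma S_reachable_live_gens:
  assumes "S_reachable V (live_gens V) L"
  obtains A where "A \<subseteq> V" "L = live_gens A"
proof -
  have "\<exists>A\<subseteq>V. L = live_gens A"
    using assms unfolding S_reachable_def
    by (induction rule: rtranclp_induct) (blast elim: S_call_live_gens)+
  then show ?thesis using that by blast
qed

lemma S_terminates: "\<nexists>L. L 0 = live_gens V \<and> (\<forall>k::nat. S_call V (L k) (L (Suc k)))"
proof
  assume "\<exists>L. L 0 = live_gens V \<and> (\<forall>k::nat. S_call V (L k) (L (Suc k)))"
  then obtain L where L: "L 0 = live_gens V" "\<And>k::nat. S_call V (L k) (L (Suc k))" by blast
  have live: "\<exists>A\<subseteq>V. L k = live_gens A" for k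
  proof (induction k)
    case 0
    show ?case using L(1) by blast
  next
    case (Suc k)
    then obtain A where A: "A \<subseteq> V" "L k = live_gens A" by blast
    then obtain B where "B \<subset> A" "L (Suc k) = live_gens B"
      using L(2)[of k] by (metis S_call_live_gens)
    with A(1) show ?case by blast
  qed
  have "(L (Suc k), L k) \<in> measure (\<lambda>L. card (nodes_of V L))" for k
  proof -
    obtain A where A: "A \<subseteq> V" "L k = live_gens A" using live by blast
    obtain B where B: "B \<subset> A" "L (Suc k) = live_gens B"
      using L(2)[of k] A by (metis S_call_live_gens)
    have "finite A" using A(1) finite_V by (rule finite_subset)
    then show ?thesis using A B psubset_card_mono[of A B] by (simp add: nodes_of_live_gens)
  qed
  then show False
    using wf_measure[unfolded wf_iff_no_infinite_down_chain] by blast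
qed

end

section \<open>Correctness of the specialized algorithm\<close>

theorem theorem2p2:
  fixes V :: "'v set" and E :: "('v \<times> 'v) set"
  assumes "finite V" and "E \<subseteq> V \<times> V" and "sym E" and "irrefl E"
  shows
    \<comment> \<open>the input\<close>
    "is_min_gens V (modified_edge_ideal V E) (edge_gens V E) \<and>
     \<comment> \<open>S terminates for all choices and never gets stuck\<close>
     (\<nexists>L. L 0 = edge_gens V E \<and> (\<forall>k::nat. S_call V (L k) (L (Suc k)))) \<and>
     (\<forall>L. S_reachable V (edge_gens V E) L \<and> \<not> only_vars_and_squares V L \<longrightarrow>
        nodes_of V L \<noteq> {} \<and> (\<forall>v\<in>nodes_of V L. \<exists>C P. S_split V L v C P)) \<and>
     (\<exists>t f. S_run V (edge_gens V E) t f) \<and>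
     \<comment> \<open>S computes the Hilbert series, and each run of S is a run of the general algorithm in which
        the pivots are the chosen variables, followed by the division\<close>
     (\<forall>t f. S_run V (edge_gens V E) t f \<longrightarrow>
        f = hilbert_series V (modified_edge_ideal V E) \<and>
        (\<exists>h. HN_run V (edge_gens V E) (map_run var t) h \<and> f = h / (1 - fps_X) ^ card V)) \<and>
     \<comment> \<open>graphical interpretation\<close>
     nodes_of V (edge_gens V E) = V \<and> edges_of V (edge_gens V E) = E \<and>
     (\<forall>L v C P. S_reachable V (edge_gens V E) L \<and> S_split V L v C P \<longrightarrow>
        nodes_of V C = nodes_of V L - {v} - {u. (v, u) \<in> edges_of V L} \<and>
        edges_of V C = edges_of V L \<inter> nodes_of V C \<times> nodes_of V C \<and>
        nodes_of V P = nodes_of V L - {v} \<and>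
        edges_of V P = edges_of V L \<inter> nodes_of V P \<times> nodes_of V P \<and>
        (\<forall>t HS_Colon. S_run V C t HS_Colon \<longrightarrow>
           HS_Colon = hilbert_series V (mono_ideal V C) \<and>
           (\<forall>k. fps_nth HS_Colon k =
              of_nat (card {S. independent_set (nodes_of V L) (edges_of V L) S \<and>
                               v \<in> S \<and> card S = k + 1}))) \<and>
        (\<forall>t HS_Plus. S_run V P t HS_Plus \<longrightarrow>
           HS_Plus = hilbert_series V (mono_ideal V P) \<and>
           (\<forall>k. fps_nth HS_Plus k =
              of_nat (card {S. independent_set (nodes_of V L) (edges_of V L) S \<and>
                               v \<notin> S \<and> card S = k}))))"
proof -
  interpret simple_graph V E using assms by unfold_locales
  have progress: "nodes_of V L \<noteq> {} \<and> (\<forall>v\<in>nodes_of V L. \<exists>C P. S_split V L v C P)"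
    if L: "S_reachable V (live_gens V) L \<and> \<not> only_vars_and_squares V L" for L
  proof -
    obtain A where "A \<subseteq> V" "L = live_gens A" using L S_reachable_live_gens by blast
    with L show ?thesis
      by (auto simp: only_vars_and_squares_live_gens nodes_of_live_gens S_split_live_gens_iff)
  qed
  have result: "f = hilbert_series V (mono_ideal V (live_gens V)) \<and>
      (\<exists>h. HN_run V (live_gens V) (map_run var t) h \<and> f = h / (1 - fps_X) ^ card V)"
    if "S_run V (live_gens V) t f" for t f
  proof -
    have "(1 - fps_X :: rat fps) \<noteq> 0"
      by (metis fps_X_neq_one right_minus_eq)
    then have "f = f * (1 - fps_X) ^ card V / (1 - fps_X) ^ card V" by simp
    then show ?thesis
      using S_run_live_gens[OF that refl] hilbert_series_live_gens[of V] by auto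
  qed
  have graph: "nodes_of V C = nodes_of V L - {v} - {u. (v, u) \<in> edges_of V L} \<and>
        edges_of V C = edges_of V L \<inter> nodes_of V C \<times> nodes_of V C \<and>
        nodes_of V P = nodes_of V L - {v} \<and>
        edges_of V P = edges_of V L \<inter> nodes_of V P \<times> nodes_of V P \<and>
        (\<forall>t HS_Colon. S_run V C t HS_Colon \<longrightarrow>
           HS_Colon = hilbert_series V (mono_ideal V C) \<and>
           (\<forall>k. fps_nth HS_Colon k =
              of_nat (card {S. independent_set (nodes_of V L) (edges_of V L) S \<and>
                               v \<in> S \<and> card S = k + 1}))) \<and>
        (\<forall>t HS_Plus. S_run V P t HS_Plus \<longrightarrow>
           HS_Plus = hilbert_series V (mono_ideal V P) \<and>
           (\<forall>k. fps_nth HS_Plus k =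
              of_nat (card {S. independent_set (nodes_of V L) (edges_of V L) S \<and>
                               v \<notin> S \<and> card S = k})))"
    if reach: "S_reachable V (live_gens V) L" and split: "S_split V L v C P" for L v C P
  proof -
    obtain A where A: "A \<subseteq> V" and L: "L = live_gens A" using reach by (rule S_reachable_live_gens)
    have v: "v \<in> A" and C: "C = live_gens (A - {v} - nbrs v)" and P: "P = live_gens (A - {v})"
      using split A unfolding L by (auto simp: S_split_live_gens_iff)
    have sub: "A - {v} - nbrs v \<subseteq> V" "A - {v} \<subseteq> V" using A by auto
    have Colon: "HS = indep_poly E (A - {v} - nbrs v)" if "S_run V C t HS" for t HS
      using S_run_live_gens[OF that C sub(1)] by simp
    have Plus: "HS = indep_poly E (A - {v})" if "S_run V P t HS" for t HS
      using S_run_live_gens[OF that P sub(2)] by simp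
    have nodes: "nodes_of V L = A" "nodes_of V C = A - {v} - nbrs v" "nodes_of V P = A - {v}"
      and edges: "edges_of V L = E \<inter> A \<times> A"
        "edges_of V C = E \<inter> (A - {v} - nbrs v) \<times> (A - {v} - nbrs v)"
        "edges_of V P = E \<inter> (A - {v}) \<times> (A - {v})"
      unfolding L C P using A sub by (simp_all only: nodes_of_live_gens edges_of_live_gens)
    have nbrs: "A - {v} - nbrs v = A - {v} - {u. (v, u) \<in> E \<inter> A \<times> A}"
      using v by (auto simp: nbrs_def)
    have series: "hilbert_series V (mono_ideal V C) = indep_poly E (A - {v} - nbrs v)"
      "hilbert_series V (mono_ideal V P) = indep_poly E (A - {v})"
      unfolding C P using sub by (simp_all only: hilbert_series_live_gens)
    have coeffs: "fps_nth (indep_poly E (A - {v} - nbrs v)) k =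
        of_nat (card {S. independent_set A E S \<and> v \<in> S \<and> card S = k + 1})"
      "fps_nth (indep_poly E (A - {v})) k =
        of_nat (card {S. independent_set A E S \<and> v \<notin> S \<and> card S = k})" for k
      unfolding independent_sets_with[OF A v] independent_sets_without by (simp_all add: indep_poly_def)
    show ?thesis
      unfolding nodes edges series independent_set_induced
    proof (intro conjI allI impI)
      show "A - {v} - nbrs v = A - {v} - {u. (v, u) \<in> E \<inter> A \<times> A}" by (rule nbrs)
    qed (auto dest!: Colon Plus simp: coeffs)
  qed
  have input: "is_min_gens V (mono_ideal V (live_gens V)) (live_gens V)"
    and run: "\<exists>t f. S_run V (live_gens V) t f"
    using min_gens_live_gens S_run_exists by simp_all
  have "nodes_of V (live_gens V) = V" "edges_of V (live_gens V) = E"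
    using nodes_of_live_gens[of V] edges_of_live_gens[of V] assms(2) by auto
  note input_graph = this
  show ?thesis
    unfolding edge_gens_eq modified_edge_ideal_eq
    by (rule conjI[OF input], rule conjI[OF S_terminates],
        rule conjI, (intro allI impI, erule progress), rule conjI[OF run],
        rule conjI, (intro allI impI, erule result),
        rule conjI[OF input_graph(1)], rule conjI[OF input_graph(2)],
        intro allI impI, elim conjE, rule graph)
qed

end
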